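(* Let $d\ge1$ and let $H=(H_0,\dots,H_d)\in(0,1)^{d+1}$ satisfy $2H_0+\sum_{i=1}^dH_i\le d$. Then the value of $\sigma_n(t,x):=\mathbb E[\Psi_n(t,x)^2]$ does not depend on $x$, and there exist constants $c_H^1,c_H^2>0$ such that for every $T>0$ and every $(t,x)\in(0,T]\times\mathbb R^d$, $$\sigma_n(t,x)\ \underset{n\to\infty}{\sim}\ \begin{cases}c_H^1\,n&\text{if }2H_0+\sum_{i=1}^dH_i=d,\\[2pt] c_H^2\,2^{2n(d-[2H_0+\sum_{i=1}^dH_i])}&\text{if }2H_0+\sum_{i=1}^dH_i<d.\end{cases}$$
   Context: $\{\Psi_n(s,x)\}_{n\ge1,s\ge0,x\in\mathbb R^d}$ is a centered real Gaussian process with covariance $$\mathbb E[\Psi_n(s,x)\Psi_m(t,y)]=c_H^2\int_{D_n\cap D_m}\frac{1}{|\xi|^{2H_0-1}}\prod_{i=1}^d\frac1{|\eta_i|^{2H_i-1}}\gamma_s(\xi,|\eta|)\overline{\gamma_t(\xi,|\eta|)}e^{i\langle\eta,x-y\rangle}d\xi d\eta,$$ where $c_H>0$ is a constant depending only on $H$, $D_n:=\{(\xi,\eta)\in\mathbb R\times\mathbb R^d:\ |\xi|\le2^{2n},\ |\eta|\le2^n\}$ and $\gamma_t(\xi,r):=e^{i\xi t}\int_0^te^{-sr^2}e^{-i\xi s}ds$. The notation $a_n\sim b_n$ means $a_n/b_n\to1$. *)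

theory Defs
  imports "HOL-Probability.Probability"
begin

text \<open>Point masses count as (degenerate) Gaussian laws, as is usual for Gaussian processes; here
  the variable at time \<open>s = 0\<close> is degenerate.\<close>

definition gaussian_rv :: "'w measure \<Rightarrow> ('w \<Rightarrow> real) \<Rightarrow> bool" where
  "gaussian_rv M Y \<longleftrightarrow> Y \<in> borel_measurable M \<and>
     ((\<exists>\<mu> \<sigma>. \<sigma> > 0 \<and> distributed M lborel Y (normal_density \<mu> \<sigma>)) \<or> (\<exists>\<mu>. AE \<omega> in M. Y \<omega> = \<mu>))"

definition centered_gaussian_process ::
    "'w measure \<Rightarrow> 'i set \<Rightarrow> ('i \<Rightarrow> 'w \<Rightarrow> real) \<Rightarrow> bool" where
  "centered_gaussian_process M I X \<longleftrightarrow> prob_space M \<and>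
     (\<forall>F a. finite F \<and> F \<subseteq> I \<longrightarrow> gaussian_rv M (\<lambda>\<omega>. \<Sum>i\<in>F. a i * X i \<omega>)) \<and>
     (\<forall>i\<in>I. (\<integral>\<omega>. X i \<omega> \<partial>M) = 0)"

definition D :: "nat \<Rightarrow> (real \<times> (real ^ 'd)) set" where
  "D n = {(\<xi>, \<eta>). \<bar>\<xi>\<bar> \<le> 2 ^ (2 * n) \<and> norm \<eta> \<le> 2 ^ n}"

definition gam :: "real \<Rightarrow> real \<Rightarrow> real \<Rightarrow> complex" where
  "gam t \<xi> r = exp (\<i> * complex_of_real (\<xi> * t)) *
     (LBINT s:{0..t}. complex_of_real (exp (- s * r\<^sup>2)) * exp (- \<i> * complex_of_real (\<xi> * s)))"

text \<open>The integrand below is Lebesgue integrable whenever all Hurst parameters are less than 1; its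
  singularities lie on null sets, where division by zero assigns the value 0.\<close>

definition Psi_cov ::
    "real \<Rightarrow> real \<Rightarrow> real ^ 'd \<Rightarrow> nat \<Rightarrow> real \<Rightarrow> real ^ 'd \<Rightarrow> nat \<Rightarrow> real \<Rightarrow> real ^ 'd \<Rightarrow> complex" where
  "Psi_cov cH H0 H n s x m t y = complex_of_real (cH\<^sup>2) *
     set_lebesgue_integral lborel (D n \<inter> D m) (\<lambda>(\<xi>, \<eta>).
       complex_of_real (1 / \<bar>\<xi>\<bar> powr (2 * H0 - 1) * (\<Prod>i\<in>UNIV. 1 / \<bar>\<eta> $ i\<bar> powr (2 * H $ i - 1)))
       * gam s \<xi> (norm \<eta>) * cnj (gam t \<xi> (norm \<eta>)) * exp (\<i> * complex_of_real (\<eta> \<bullet> (x - y))))"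

definition is_Psi ::
    "real \<Rightarrow> real \<Rightarrow> real ^ 'd \<Rightarrow> 'w measure \<Rightarrow> (nat \<Rightarrow> real \<Rightarrow> real ^ 'd \<Rightarrow> 'w \<Rightarrow> real) \<Rightarrow> bool" where
  "is_Psi cH H0 H M \<Psi> \<longleftrightarrow>
     centered_gaussian_process M {(n, s, x). n \<ge> 1 \<and> s \<ge> 0} (\<lambda>(n, s, x). \<Psi> n s x) \<and>
     (\<forall>n\<ge>1. \<forall>m\<ge>1. \<forall>s\<ge>0. \<forall>t\<ge>0. \<forall>x y.
        complex_of_real (\<integral>\<omega>. \<Psi> n s x \<omega> * \<Psi> m t y \<omega> \<partial>M) = Psi_cov cH H0 H n s x m t y)"

definition Psi_sigma ::
    "'w measure \<Rightarrow> (nat \<Rightarrow> real \<Rightarrow> real ^ 'd \<Rightarrow> 'w \<Rightarrow> real) \<Rightarrow> nat \<Rightarrow> real \<Rightarrow> real ^ 'd \<Rightarrow> real" where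
  "Psi_sigma M \<Psi> n t x = (\<integral>\<omega>. (\<Psi> n t x \<omega>)\<^sup>2 \<partial>M)"

end

theory Submission
  imports Defs
begin

text \<open>
  Up to the factor \<open>c\<^sub>H\<^sup>2\<close>, the variance is the integral over \<open>D\<^sub>n\<close> of the weight times
  \<open>\<bar>\<gamma>\<^sub>t\<bar>\<^sup>2 = \<bar>1 - exp (- t z)\<bar>\<^sup>2 / \<bar>z\<bar>\<^sup>2\<close>, where \<open>z = \<bar>\<eta>\<bar>\<^sup>2 + i \<xi>\<close>. The parabolic dilation
  \<open>(\<xi>, \<eta>) \<mapsto> (4\<^sup>n \<xi>, 2\<^sup>n \<eta>)\<close> maps the shell \<open>D\<^sub>1 - D\<^sub>0\<close> onto \<open>D\<^sub>n\<^sub>+\<^sub>1 - D\<^sub>n\<close>, and the weight and \<open>z\<close> are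
  homogeneous for it; so the increment of the variance from \<open>n\<close> to \<open>n + 1\<close> is
  \<open>4 powr (n \<delta>)\<close>, with \<open>\<delta> = d - (2 H\<^sub>0 + \<Sum> H\<^sub>i)\<close>, times a shell integral in which \<open>t\<close> is replaced
  by \<open>4\<^sup>n t\<close>. On the shell \<open>\<bar>z\<bar> \<ge> 1\<close>, and dominated convergence makes these integrals tend to
  a positive limit that does not depend on \<open>t\<close>. The Stolz-Cesaro theorem then gives both regimes
  at once: linear growth for \<open>\<delta> = 0\<close> and geometric growth for \<open>\<delta> > 0\<close>.
\<close>

section \<open>A Stolz-Cesaro theorem for strictly increasing, unbounded denominators\<close>

lemma stolz_cesaro_mono:
  fixes a B :: "nat \<Rightarrow> real"
  assumes mono: "\<And>n. B n < B (Suc n)" and B: "filterlim B at_top sequentially"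
    and lim: "(\<lambda>n. (a (Suc n) - a n) / (B (Suc n) - B n)) \<longlonglongrightarrow> l"
  shows "(\<lambda>n. a n / B n) \<longlonglongrightarrow> l"
proof (rule LIMSEQ_I)
  fix r :: real assume r: "r > 0"
  \<comment> \<open>After removing the linear part, the goal becomes
    \<open>\<bar>e n\<bar> < r * B n\<close> for large \<open>n\<close>. The tolerance
    \<open>r\<close> is split: one half bounds the increments of \<open>e\<close>, the other absorbs
    the starting values at \<open>N\<close>.\<close>
  define e where "e n = a n - l * B n" for n
  from LIMSEQ_D[OF lim, of "r/2"] r obtain N where
    N: "\<And>n. n \<ge> N \<Longrightarrow> \<bar>(a (Suc n) - a n) / (B (Suc n) - B n) - l\<bar> < r/2" by auto
  have incr: "\<bar>e (Suc n) - e n\<bar> \<le> r/2 * (B (Suc n) - B n)" if "n \<ge> N" for n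
  proof -
    have pos: "B (Suc n) - B n > 0" using mono[of n] by simp
    have "e (Suc n) - e n = ((a (Suc n) - a n) / (B (Suc n) - B n) - l) * (B (Suc n) - B n)"
      using pos by (simp add: e_def field_simps)
    then show ?thesis using N[OF that] pos by (simp add: abs_mult)
  qed
  have tele: "\<bar>e n\<bar> \<le> \<bar>e N\<bar> + r/2 * (B n - B N)" if "n \<ge> N" for n
    using that
  proof (induction n rule: dec_induct)
    case (step n)
    have "\<bar>e (Suc n)\<bar> \<le> \<bar>e n\<bar> + \<bar>e (Suc n) - e n\<bar>" by simp
    moreover have "r/2 * (B (Suc n) - B N) = r/2 * (B n - B N) + r/2 * (B (Suc n) - B n)"
      by (simp add: field_simps)
    ultimately show ?case using step.IH incr[OF step.hyps(1)] by linarith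
  qed simp
  \<comment> \<open>The second threshold says exactly that \<open>r/2 * B n\<close> exceeds every
    constant left over from telescoping; the bound 1 keeps the denominator positive.\<close>
  have "eventually (\<lambda>n. B n > max 1 ((\<bar>e N\<bar> + r/2 * \<bar>B N\<bar> + 1) * 2 / r)) sequentially"
    using B by (auto simp only: filterlim_at_top_dense)
  then obtain K where K: "\<And>n. n \<ge> K \<Longrightarrow> B n > max 1 ((\<bar>e N\<bar> + r/2 * \<bar>B N\<bar> + 1) * 2 / r)"
    by (auto simp: eventually_sequentially)
  show "\<exists>no. \<forall>n\<ge>no. norm (a n / B n - l) < r"
  proof (intro exI allI impI)
    fix n assume n: "n \<ge> max N K"
    have Bn: "B n > 1" "r/2 * B n > \<bar>e N\<bar> + r/2 * \<bar>B N\<bar> + 1"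
      using K[of n] n r by (auto simp: field_simps)
    have "- (r/2 * B N) \<le> r/2 * \<bar>B N\<bar>"
      using mult_left_mono[of "- B N" "\<bar>B N\<bar>" "r/2"] r by simp
    moreover have "\<bar>e n\<bar> \<le> \<bar>e N\<bar> + r/2 * B n - r/2 * B N"
      using tele[of n] n by (simp add: field_simps)
    ultimately have "\<bar>e n\<bar> < r/2 * B n + r/2 * B n" using Bn(2) by linarith
    then have "\<bar>e n\<bar> < r * B n" by simp
    moreover have "a n / B n - l = e n / B n" using Bn by (simp add: e_def field_simps)
    ultimately show "norm (a n / B n - l) < r" using Bn by (simp add: field_simps)
  qed
qed

section \<open>The singular weight: local integrability and coordinates\<close>

lemma nn_integral_abs_powr_finite:
  fixes e R :: real
  assumes "e < 1" "R \<ge> 0"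
  shows "(\<integral>\<^sup>+x. ennreal (indicator {-R..R} x * (1 / \<bar>x\<bar> powr e)) \<partial>lborel) < \<infinity>"
proof -
  let ?f = "\<lambda>x::real. 1 / \<bar>x\<bar> powr e"
  have "(\<lambda>x::real. x powr (-e)) integrable_on {0..R}"
    using assms by (intro integrable_on_powr_from_0) auto
  then have 1: "?f integrable_on {0..R}"
    \<comment> \<open>The two integrands agree at 0 as well: \<open>0 powr a\<close> is 0, and so is
      division by zero.\<close>
    by (rule integrable_eq) (auto simp: powr_minus_divide)
  then have 2: "?f integrable_on {-R..0}"
    using Henstock_Kurzweil_Integration.integrable_reflect_real[of ?f R 0] by simp
  have "?f integrable_on {-R..R}"
    using assms by (intro Henstock_Kurzweil_Integration.integrable_combine[OF _ _ 2 1]) auto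
  then obtain I where "(?f has_integral I) {-R..R}" by auto
  then have "((\<lambda>x. if x \<in> {-R..R} then ?f x else 0) has_integral I) UNIV"
    by (simp only: has_integral_restrict_UNIV)
  then have "((\<lambda>x. indicator {-R..R} x * ?f x) has_integral I) UNIV"
    by (rule has_integral_eq[rotated]) auto
  then have "(\<integral>\<^sup>+x. ennreal (indicator {-R..R} x * ?f x) \<partial>lborel) = ennreal I"
    by (intro nn_integral_has_integral_lborel) auto
  then show ?thesis by simp
qed

text \<open>Taking \<open>h\<close> to be the vector \<open>(H0, H)\<close> treats the time and
  space frequencies alike, so that Tonelli and dilation arguments run over one basis.\<close>

definition hurst_weight :: "'a::euclidean_space \<Rightarrow> 'a \<Rightarrow> real" where
  "hurst_weight h p = (\<Prod>b\<in>Basis. 1 / \<bar>p \<bullet> b\<bar> powr (2 * (h \<bullet> b) - 1))"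

lemma hurst_weight_measurable [measurable]: "hurst_weight h \<in> borel_measurable borel"
  unfolding hurst_weight_def [abs_def] by measurable

lemma hurst_weight_nonneg: "hurst_weight h p \<ge> 0"
  by (simp add: hurst_weight_def prod_nonneg)

text \<open>A bounded set lies in a cube of half-width \<open>R\<close>, where Tonelli splits the
  integral into one-dimensional ones. Each has exponent \<open>2 * (h \<bullet> b) - 1 < 1\<close>,
  hence an integrable singularity at 0.\<close>

lemma hurst_weight_integrable:
  fixes h :: "'a::euclidean_space"
  assumes h: "\<And>b. b \<in> Basis \<Longrightarrow> h \<bullet> b < 1"
    and A: "A \<in> sets borel" "bounded A"
  shows "set_integrable lborel A (hurst_weight h)"
proof -
  obtain R where R: "R > 0" "\<And>p. p \<in> A \<Longrightarrow> norm p \<le> R"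
    using A(2) unfolding bounded_pos by auto
  let ?g = "\<lambda>b x. indicator {-R..R} x * (1 / \<bar>x\<bar> powr (2 * (h \<bullet> b) - 1))"
  have fin: "(\<integral>\<^sup>+x. ennreal (\<Prod>b\<in>Basis. ?g b (x \<bullet> b)) \<partial>lborel) < \<infinity>"
  proof -
    have "(\<integral>\<^sup>+x. ennreal (\<Prod>b\<in>Basis. ?g b (x \<bullet> b)) \<partial>lborel)
        = (\<integral>\<^sup>+(x::'a). (\<Prod>b\<in>Basis. ennreal (?g b (x \<bullet> b))) \<partial>lborel)"
      by (simp add: prod_ennreal)
    also have "\<dots> = (\<Prod>b\<in>Basis. (\<integral>\<^sup>+x. ennreal (?g b x) \<partial>lborel))"
      by (intro nn_integral_lborel_prod) auto
    also have "\<dots> < \<infinity>"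
    proof -
      have "(\<integral>\<^sup>+x. ennreal (?g b x) \<partial>lborel) \<noteq> \<top>" if "b \<in> Basis" for b :: 'a
        using nn_integral_abs_powr_finite[of "2 * (h \<bullet> b) - 1" R] R(1) h[OF that] by simp
      then show ?thesis
        unfolding infinity_ennreal_def less_top[symmetric] ennreal_prod_eq_top by blast
    qed
    finally show ?thesis .
  qed
  have int: "integrable lborel (\<lambda>x::'a. \<Prod>b\<in>Basis. ?g b (x \<bullet> b))"
    using fin by (subst integrable_iff_bounded) (auto simp: abs_prod abs_mult)
  show ?thesis unfolding set_integrable_def
  proof (rule Bochner_Integration.integrable_bound[OF int])
    show "(\<lambda>p. indicat_real A p *\<^sub>R hurst_weight h p) \<in> borel_measurable lborel"
      using A by measurable
    show "AE p in lborel. norm (indicat_real A p *\<^sub>R hurst_weight h p)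
            \<le> norm (\<Prod>b\<in>Basis. ?g b (p \<bullet> b))"
    proof (rule AE_I2)
      fix p :: 'a
      show "norm (indicat_real A p *\<^sub>R hurst_weight h p) \<le> norm (\<Prod>b\<in>Basis. ?g b (p \<bullet> b))"
      proof (cases "p \<in> A")
        case True
        have "p \<bullet> b \<in> {-R..R}" if "b \<in> Basis" for b
          using Basis_le_norm[OF that, of p] R(2)[OF True] by (auto simp: abs_le_iff)
        then have "(\<Prod>b\<in>Basis. ?g b (p \<bullet> b)) = hurst_weight h p"
          unfolding hurst_weight_def by (intro prod.cong) auto
        then show ?thesis using True by simp
      qed auto
    qed
  qed
qed

text \<open>On the coordinate hyperplanes division by zero makes \<open>hurst_weight\<close> vanish.
  Discarding them is what makes the weight strictly positive almost everywhere.\<close>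

lemma AE_lborel_inner_nonzero:
  "AE p in lborel. \<forall>b\<in>Basis. (p::'a::euclidean_space) \<bullet> b \<noteq> 0"
proof (rule AE_finite_allI[OF finite_Basis])
  fix b :: 'a assume b: "b \<in> Basis"
  have "negligible {x::'a. x \<bullet> b = 0}"
    using b by (rule negligible_standard_hyperplane)
  then have "{x::'a. x \<bullet> b = 0} \<in> null_sets lborel"
    by (simp add: negligible_iff_null_sets null_sets_completion_iff)
  then show "AE p in lborel. p \<bullet> b \<noteq> 0"
    by (rule AE_not_in[THEN AE_mp]) auto
qed

lemma prod_Basis_real_vec:
  fixes f :: "real \<times> (real ^ 'd) \<Rightarrow> 'a::comm_monoid_mult"
  shows "(\<Prod>b\<in>Basis. f b) = f (1, 0) * (\<Prod>i\<in>UNIV. f (0, axis i 1))"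
proof -
  have "(\<Prod>b\<in>Basis. f b) = (\<Prod>b\<in>(\<lambda>u. (u, 0)) ` Basis. f b) * (\<Prod>b\<in>(\<lambda>v. (0, v)) ` Basis. f b)"
    unfolding Basis_prod_def by (rule prod.union_disjoint) auto
  also have "(\<Prod>b\<in>(\<lambda>u. (u, 0)) ` Basis. f b) = f (1, 0)" by simp
  also have "(\<Prod>b\<in>(\<lambda>v. (0, v)) ` Basis. f b) = (\<Prod>i\<in>UNIV. f (0, axis i 1))"
  proof -
    have "(\<lambda>v. (0::real, v)) ` (Basis :: (real^'d) set) = range (\<lambda>i. (0, axis i 1))"
      by (auto simp: Basis_vec_def)
    then show ?thesis
      by (simp add: prod.reindex inj_on_def axis_eq_axis)
  qed
  finally show ?thesis .
qed

lemma hurst_weight_real_vec: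
  "hurst_weight (H0, H) (\<xi>, \<eta> :: real ^ 'd) =
     1 / \<bar>\<xi>\<bar> powr (2 * H0 - 1) * (\<Prod>i\<in>UNIV. 1 / \<bar>\<eta> $ i\<bar> powr (2 * H $ i - 1))"
  unfolding hurst_weight_def prod_Basis_real_vec by (simp add: cart_eq_inner_axis)

section \<open>Parabolic dilation of Lebesgue measure and of the weight\<close>

lemma lborel_integral_parabolic:
  fixes f :: "real \<times> 'a::euclidean_space \<Rightarrow> real"
  assumes [measurable]: "f \<in> borel_measurable borel" and r: "r > 0"
  shows "(\<integral>p. f p \<partial>lborel) =
    r ^ (2 + DIM('a)) * (\<integral>p. f (r\<^sup>2 * fst p, r *\<^sub>R snd p) \<partial>lborel)"
proof -
  define c where "c b = (if b = (1, 0) then r\<^sup>2 else r)" for b :: "real \<times> 'a"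
  define S where "S p = (r\<^sup>2 * fst p, r *\<^sub>R snd p)" for p :: "real \<times> 'a"
  have [measurable]: "S \<in> borel_measurable borel"
    unfolding S_def [abs_def] by (intro borel_measurable_continuous_onI continuous_intros)
  \<comment> \<open>The dilation is diagonal in \<open>Basis\<close>, with factor
    \<open>r\<^sup>2\<close> along \<open>(1, 0)\<close> and \<open>r\<close> along every spatial
    direction. This is the form required by \<open>lborel_affine_euclidean\<close>; the Jacobian is
    the product of the factors.\<close>
  have S: "S = (\<lambda>p. 0 + (\<Sum>j\<in>Basis. (c j * (p \<bullet> j)) *\<^sub>R j))"
  proof (rule ext, rule euclidean_eqI)
    fix p b :: "real \<times> 'a" assume b: "b \<in> Basis"
    then have "(0 + (\<Sum>j\<in>Basis. (c j * (p \<bullet> j)) *\<^sub>R j)) \<bullet> b = c b * (p \<bullet> b)"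
      by (simp only: inner_sum_left_Basis add_0)
    also have "\<dots> = S p \<bullet> b"
    proof -
      consider "b = (1, 0)" | v where "b = (0, v)" "v \<in> Basis"
        using b unfolding Basis_prod_def by auto
      then show ?thesis by cases (simp_all add: c_def S_def inner_prod_def)
    qed
    finally show "S p \<bullet> b = (0 + (\<Sum>j\<in>Basis. (c j * (p \<bullet> j)) *\<^sub>R j)) \<bullet> b" ..
  qed
  have prod_c: "(\<Prod>j\<in>Basis. \<bar>c j\<bar>) = r ^ (2 + DIM('a))"
  proof -
    have "(\<Prod>j\<in>Basis. \<bar>c j\<bar>) = (\<Prod>j\<in>(\<lambda>u. (u, 0)) ` Basis. \<bar>c j\<bar>) * (\<Prod>j\<in>(\<lambda>v. (0, v)) ` Basis. \<bar>c j\<bar>)"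
      unfolding Basis_prod_def by (rule prod.union_disjoint) auto
    also have "\<dots> = r ^ (2 + DIM('a))"
      using r by (simp add: prod.reindex inj_on_def c_def power_add power2_eq_square)
    finally show ?thesis .
  qed
  have "lborel = density (distr lborel borel S) (\<lambda>_. ennreal (r ^ (2 + DIM('a))))"
    unfolding S prod_c[symmetric]
    by (rule lborel_affine_euclidean) (use r in \<open>auto simp: c_def\<close>)
  then have "(\<integral>p. f p \<partial>lborel) = (\<integral>p. f p \<partial>density (distr lborel borel S) (\<lambda>_. ennreal (r ^ (2 + DIM('a)))))"
    by simp
  also have "\<dots> = (\<integral>p. r ^ (2 + DIM('a)) *\<^sub>R f p \<partial>distr lborel borel S)"
    using r by (intro integral_density) auto
  also have "\<dots> = (\<integral>p. r ^ (2 + DIM('a)) *\<^sub>R f (S p) \<partial>lborel)"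
    by (intro integral_distr) auto
  finally show ?thesis by (simp add: S_def)
qed

lemma hurst_weight_parabolic:
  fixes H :: "real ^ 'd"
  assumes r: "r > 0"
  shows "hurst_weight (H0, H) (r\<^sup>2 * fst p, r *\<^sub>R snd p) =
    r powr (2 + real CARD('d) - 2 * (2 * H0 + (\<Sum>i\<in>UNIV. H $ i))) * hurst_weight (H0, H) p"
proof -
  obtain \<xi> \<eta> where p: "p = (\<xi>, \<eta>)" by (cases p)
  have 1: "\<bar>s * x\<bar> powr a = s powr a * \<bar>x\<bar> powr a" if "s > 0" for s x a :: real
    using that by (simp add: abs_mult powr_mult)
  have "hurst_weight (H0, H) (r\<^sup>2 * fst p, r *\<^sub>R snd p)
      = 1 / ((r\<^sup>2) powr (2 * H0 - 1) * (\<Prod>i\<in>UNIV. r powr (2 * H $ i - 1))) * hurst_weight (H0, H) p"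
    using r by (simp add: p hurst_weight_real_vec 1 prod_dividef prod.distrib)
  also have "(r\<^sup>2) powr (2 * H0 - 1) * (\<Prod>i\<in>UNIV. r powr (2 * H $ i - 1))
      = r powr (2 * (2 * H0 - 1) + (\<Sum>i\<in>UNIV. 2 * H $ i - 1))"
  proof -
    have "(r\<^sup>2) powr (2 * H0 - 1) = r powr (2 * (2 * H0 - 1))"
      using r powr_powr[of r 2 "2 * H0 - 1"] by simp
    then show ?thesis using r by (simp only: powr_add powr_sum)
  qed
  also have "1 / \<dots> = r powr - (2 * (2 * H0 - 1) + (\<Sum>i\<in>UNIV. 2 * H $ i - 1))"
    by (rule powr_minus_divide[symmetric])
  also have "- (2 * (2 * H0 - 1) + (\<Sum>i\<in>UNIV. 2 * H $ i - 1))
      = 2 + real CARD('d) - 2 * (2 * H0 + (\<Sum>i\<in>UNIV. H $ i))"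
    by (simp add: sum_subtractf sum_distrib_left)
  finally show ?thesis .
qed

section \<open>The Fourier symbol of the heat operator and the modulus of \<open>gam\<close>\<close>

definition heat_symbol :: "real \<times> 'a::euclidean_space \<Rightarrow> complex" where
  "heat_symbol p = complex_of_real ((norm (snd p))\<^sup>2) + \<i> * complex_of_real (fst p)"

lemma heat_symbol_measurable [measurable]: "heat_symbol \<in> borel_measurable borel"
  unfolding heat_symbol_def [abs_def]
  by (intro borel_measurable_continuous_onI continuous_intros)

lemma Re_heat_symbol [simp]: "Re (heat_symbol p) = (norm (snd p))\<^sup>2"
  and Im_heat_symbol [simp]: "Im (heat_symbol p) = fst p"
  by (simp_all add: heat_symbol_def)

lemma heat_symbol_parabolic:
  assumes "r > 0"
  shows "heat_symbol (r\<^sup>2 * fst p, r *\<^sub>R snd p) = complex_of_real (r\<^sup>2) * heat_symbol p"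
  using assms by (simp add: heat_symbol_def power_mult_distrib algebra_simps)

lemma gam_integrand:
  "complex_of_real (exp (- s * (norm (snd p))\<^sup>2)) * exp (- \<i> * complex_of_real (fst p * s))
     = exp (- (complex_of_real s * heat_symbol p))"
proof -
  have "complex_of_real (exp (- s * (norm (snd p))\<^sup>2)) = exp (complex_of_real (- s * (norm (snd p))\<^sup>2))"
    by (rule exp_of_real[symmetric])
  then show ?thesis
    by (simp only: exp_add[symmetric]) (simp add: heat_symbol_def algebra_simps)
qed

text \<open>The integrand is exp(-s z) with z the heat symbol, and -exp(-s z)/z is a primitive. The
  oscillating prefactor has modulus 1 and disappears from \<open>norm_gam_eq\<close>.\<close>

lemma gam_eq:
  assumes "t \<ge> 0" "heat_symbol p \<noteq> 0"
  shows "gam t (fst p) (norm (snd p)) = exp (\<i> * complex_of_real (fst p * t)) *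
     ((1 - exp (- (complex_of_real t * heat_symbol p))) / heat_symbol p)"
proof -
  let ?z = "heat_symbol p"
  let ?F = "\<lambda>s::real. - exp (- (complex_of_real s * ?z)) / ?z"
  have "integral\<^sup>L lborel (\<lambda>s. indicator {0..t} s *\<^sub>R exp (- (complex_of_real s * ?z))) = ?F t - ?F 0"
  proof (rule integral_FTC_atLeastAtMost)
    fix s :: real
    show "(?F has_vector_derivative exp (- (complex_of_real s * ?z))) (at s within {0..t})"
    proof (rule has_vector_derivative_real_field)
      show "((\<lambda>w. - exp (- (w * ?z)) / ?z) has_field_derivative exp (- (complex_of_real s * ?z)))
              (at (complex_of_real s))"
        using assms by (auto intro!: derivative_eq_intros simp: field_simps)
    qed
  qed (use assms in \<open>auto intro!: continuous_intros\<close>)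
  then show ?thesis
    using assms unfolding gam_def set_lebesgue_integral_def gam_integrand
    by (simp add: diff_divide_distrib)
qed

lemma norm_gam_eq:
  assumes "t \<ge> 0" "heat_symbol p \<noteq> 0"
  shows "cmod (gam t (fst p) (norm (snd p))) =
     cmod (1 - exp (- (complex_of_real t * heat_symbol p))) / cmod (heat_symbol p)"
  using assms by (simp add: gam_eq norm_mult norm_divide)

lemma norm_gam_0:
  assumes "t \<ge> 0" "heat_symbol p = 0"
  shows "cmod (gam t (fst p) (norm (snd p))) = t"
  using assms unfolding gam_def set_lebesgue_integral_def gam_integrand
  by (simp add: norm_mult)

text \<open>The closed formula needs a separate value where the symbol vanishes: there the quotient
  would evaluate to 0, whereas the true modulus is \<open>t\<close>.\<close>

lemma norm_gam_measurable:
  assumes "t \<ge> 0"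
  shows "(\<lambda>p :: real \<times> 'a::euclidean_space. cmod (gam t (fst p) (norm (snd p)))) \<in> borel_measurable borel"
proof -
  have "(\<lambda>p :: real \<times> 'a. cmod (gam t (fst p) (norm (snd p)))) =
     (\<lambda>p. if heat_symbol p = 0 then t
        else cmod (1 - exp (- (complex_of_real t * heat_symbol p))) / cmod (heat_symbol p))"
    using assms by (intro ext) (simp add: norm_gam_eq norm_gam_0)
  also have "\<dots> \<in> borel_measurable borel" by measurable
  finally show ?thesis .
qed

text \<open>The symbol has nonnegative real part, so the integrand has modulus at most 1 on
  \<open>{0..t}\<close>. Unlike the quotient formula, this controls \<open>gam\<close> near the
  origin and makes the variance integrals over \<open>D n\<close> converge.\<close>

lemma norm_gam_le:
  fixes p :: "real \<times> 'a::euclidean_space"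
  assumes "t \<ge> 0"
  shows "cmod (gam t (fst p) (norm (snd p))) \<le> t"
proof -
  let ?f = "\<lambda>s. indicator {0..t} s *\<^sub>R exp (- (complex_of_real s * heat_symbol p))"
  have "cmod (integral\<^sup>L lborel ?f) \<le> integral\<^sup>L lborel (\<lambda>s. indicator {0..t} s)"
  proof (rule Bochner_Integration.integral_norm_bound_integral)
    have "set_integrable lborel {0..t} (\<lambda>s. exp (- (complex_of_real s * heat_symbol p)))"
      by (intro borel_integrable_atLeastAtMost' continuous_intros)
    then show "integrable lborel ?f" by (simp add: set_integrable_def)
    show "integrable lborel (indicat_real {0..t})"
      using assms by (intro integrable_real_indicator) auto
    show "\<And>s. norm (?f s) \<le> indicat_real {0..t} s"
      by (auto simp: indicator_def)
  qed
  then show ?thesis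
    using assms unfolding gam_def set_lebesgue_integral_def gam_integrand
    by (simp add: norm_mult)
qed

lemma filterlim_realpow_at_top:
  assumes "(x::real) > 1"
  shows "filterlim (\<lambda>n. x ^ n) at_top sequentially"
  by (rule filterlim_at_infinity_imp_filterlim_at_top)
     (use assms in \<open>auto intro!: filterlim_realpow_sequentially_gt1\<close>)

section \<open>The frequency boxes and the shell between the first two\<close>

lemma mem_D_iff: "p \<in> D n \<longleftrightarrow> \<bar>fst p\<bar> \<le> 2 ^ (2 * n) \<and> norm (snd p) \<le> 2 ^ n"
  by (cases p) (simp add: D_def)

lemma D_borel [measurable]: "(D n :: (real \<times> (real ^ 'd)) set) \<in> sets borel"
proof -
  have "closed {p :: real \<times> (real ^ 'd). \<bar>fst p\<bar> \<le> 2 ^ (2 * n) \<and> norm (snd p) \<le> 2 ^ n}"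
    by (intro closed_Collect_conj closed_Collect_le continuous_intros)
  also have "{p :: real \<times> (real ^ 'd). \<bar>fst p\<bar> \<le> 2 ^ (2 * n) \<and> norm (snd p) \<le> 2 ^ n} = D n"
    by (auto simp: mem_D_iff)
  finally show ?thesis by (rule borel_closed)
qed

lemma bounded_D: "bounded (D n :: (real \<times> (real ^ 'd)) set)"
proof (rule boundedI)
  fix p :: "real \<times> (real ^ 'd)" assume "p \<in> D n"
  then show "norm p \<le> 2 ^ (2 * n) + 2 ^ n"
    using norm_Pair_le[of "fst p" "snd p"] by (simp add: mem_D_iff)
qed

lemma D_mono: "m \<le> n \<Longrightarrow> D m \<subseteq> D n"
  by (auto simp: mem_D_iff elim!: order_trans intro!: power_increasing)

text \<open>The thresholds \<open>2 ^ (2 * n)\<close> and \<open>2 ^ n\<close> scale exactly like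
  the two components of the dilation. The cases \<open>k = 0\<close> and \<open>k = 1\<close>
  together carry \<open>shell\<close> to \<open>D (Suc n) - D n\<close>.\<close>

lemma parabolic_mem_D_iff:
  "((2 ^ n)\<^sup>2 * fst p, 2 ^ n *\<^sub>R snd p) \<in> D (n + k) \<longleftrightarrow> p \<in> D k"
proof -
  have "\<bar>(2 ^ n)\<^sup>2 * fst p\<bar> \<le> 2 ^ (2 * (n + k)) \<longleftrightarrow> (2 ^ n)\<^sup>2 * \<bar>fst p\<bar> \<le> (2 ^ n)\<^sup>2 * 2 ^ (2 * k)"
    by (simp add: abs_mult power_add power_mult power2_eq_square algebra_simps flip: power_mult_distrib)
  moreover have "2 ^ n * norm (snd p) \<le> 2 ^ (n + k) \<longleftrightarrow> norm (snd p) \<le> 2 ^ k"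
    by (simp add: power_add)
  ultimately show ?thesis
    by (simp add: mem_D_iff)
qed

definition shell :: "(real \<times> (real ^ 'd)) set" where
  "shell = D 1 - D 0"

lemma shell_borel [measurable]: "shell \<in> sets borel"
  unfolding shell_def by measurable

text \<open>A point outside \<open>D 0\<close> has a large time or a large space frequency, and the
  modulus of the symbol dominates both its imaginary and its real part.\<close>

lemma one_le_norm_heat_symbol:
  assumes "p \<in> shell"
  shows "1 \<le> cmod (heat_symbol p)"
proof -
  from assms consider "1 < \<bar>fst p\<bar>" | "1 < norm (snd p)"
    by (auto simp: shell_def mem_D_iff)
  then show ?thesis
  proof cases
    case 1
    then show ?thesis using abs_Im_le_cmod[of "heat_symbol p"] by simp
  next
    case 2
    then have "1 \<le> (norm (snd p))\<^sup>2" by (simp add: one_le_power)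
    then show ?thesis using complex_Re_le_cmod[of "heat_symbol p"] by simp
  qed
qed

section \<open>The variance as a spectral integral and its increments\<close>

definition spectral_energy :: "real \<times> (real ^ 'd) \<Rightarrow> real \<Rightarrow> nat \<Rightarrow> real" where
  "spectral_energy h t n =
     (LINT p:D n|lborel. hurst_weight h p * (cmod (gam t (fst p) (norm (snd p))))\<^sup>2)"

text \<open>For equal arguments the phase is 1 and \<open>gam\<close> times its conjugate is a
  squared modulus. The point \<open>x\<close> drops out, which gives the independence of the
  variance from \<open>x\<close>.\<close>

lemma Psi_cov_diagonal:
  "Psi_cov cH H0 H n t x n t x = complex_of_real (cH\<^sup>2 * spectral_energy (H0, H) t n)"
proof -
  have "(\<lambda>(\<xi>, \<eta>).
       complex_of_real (1 / \<bar>\<xi>\<bar> powr (2 * H0 - 1) * (\<Prod>i\<in>UNIV. 1 / \<bar>\<eta> $ i\<bar> powr (2 * H $ i - 1)))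
       * gam t \<xi> (norm \<eta>) * cnj (gam t \<xi> (norm \<eta>)) * exp (\<i> * complex_of_real (\<eta> \<bullet> (x - x))))
     = (\<lambda>p. complex_of_real (hurst_weight (H0, H) p * (cmod (gam t (fst p) (norm (snd p))))\<^sup>2))"
    by (rule ext) (auto simp: hurst_weight_real_vec mult.assoc complex_norm_square[symmetric])
  then show ?thesis
    unfolding Psi_cov_def spectral_energy_def Int_absorb
    by (simp only: set_integral_complex_of_real of_real_mult[of "cH\<^sup>2"])
qed

lemma inner_Basis_real_vec_less:
  assumes "H0 < a" "\<And>i. H $ i < a" "b \<in> Basis"
  shows "(H0, H :: real ^ 'd) \<bullet> b < a"
  using assms by (auto simp: Basis_prod_def Basis_vec_def inner_prod_def cart_eq_inner_axis)

lemma spectral_integrable: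
  fixes H :: "real ^ 'd"
  assumes "H0 < 1" "\<And>i. H $ i < 1" "t \<ge> 0" "A \<in> sets borel" "bounded A"
  shows "set_integrable lborel A
    (\<lambda>p. hurst_weight (H0, H) p * (cmod (gam t (fst p) (norm (snd p))))\<^sup>2)"
proof -
  have W: "set_integrable lborel A (\<lambda>p. hurst_weight (H0, H) p * t\<^sup>2)"
    using hurst_weight_integrable[OF inner_Basis_real_vec_less[OF assms(1,2)] assms(4,5)] by simp
  have [measurable]: "(\<lambda>p :: real \<times> (real ^ 'd). cmod (gam t (fst p) (norm (snd p)))) \<in> borel_measurable borel"
    by (rule norm_gam_measurable[OF \<open>t \<ge> 0\<close>])
  show ?thesis
  proof (rule set_integrable_bound[OF W])
    show "set_borel_measurable lborel A
      (\<lambda>p. hurst_weight (H0, H) p * (cmod (gam t (fst p) (norm (snd p))))\<^sup>2)"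
      unfolding set_borel_measurable_def using assms(4) by measurable
    show "AE p in lborel. p \<in> A \<longrightarrow>
        norm (hurst_weight (H0, H) p * (cmod (gam t (fst p) (norm (snd p))))\<^sup>2)
          \<le> norm (hurst_weight (H0, H) p * t\<^sup>2)"
      using norm_gam_le[OF \<open>t \<ge> 0\<close>] hurst_weight_nonneg[of "(H0, H)"]
      by (intro AE_I2 impI) (auto simp: abs_mult intro!: mult_left_mono power_mono)
  qed
qed

lemma spectral_energy_Suc_diff:
  fixes H :: "real ^ 'd"
  assumes "H0 < 1" "\<And>i. H $ i < 1" "t \<ge> 0"
  defines "\<delta> \<equiv> real CARD('d) - (2 * H0 + (\<Sum>i\<in>UNIV. H $ i))"
  shows "spectral_energy (H0, H) t (Suc n) - spectral_energy (H0, H) t n =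
    (2 powr (2 * \<delta>)) ^ n * (LINT p:shell|lborel. hurst_weight (H0, H) p *
       (cmod (1 - exp (- (complex_of_real (t * 4 ^ n) * heat_symbol p))))\<^sup>2 / (cmod (heat_symbol p))\<^sup>2)"
    (is "_ = _ * (LINT p:shell|lborel. ?w p)")
proof -
  let ?f = "\<lambda>p. hurst_weight (H0, H) p * (cmod (gam t (fst p) (norm (snd p))))\<^sup>2"
  define r :: real where "r = 2 ^ n"
  let ?S = "\<lambda>p :: real \<times> (real ^ 'd). (r\<^sup>2 * fst p, r *\<^sub>R snd p)"
  define A :: "(real \<times> (real ^ 'd)) set" where "A = D (Suc n) - D n"
  have r: "r > 0" by (simp add: r_def)
  have [measurable]: "A \<in> sets borel" by (simp add: A_def)
  have [measurable]: "(\<lambda>p :: real \<times> (real ^ 'd). cmod (gam t (fst p) (norm (snd p)))) \<in> borel_measurable borel"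
    by (rule norm_gam_measurable[OF \<open>t \<ge> 0\<close>])
  have int: "set_integrable lborel (D m) ?f" for m
    using assms by (intro spectral_integrable bounded_D) auto
  have "spectral_energy (H0, H) t (Suc n) = (LINT p:D n \<union> A|lborel. ?f p)"
    unfolding spectral_energy_def A_def Un_Diff_cancel
    by (subst Un_absorb1) (simp_all add: D_mono)
  also have "\<dots> = spectral_energy (H0, H) t n + (LINT p:A|lborel. ?f p)"
    unfolding spectral_energy_def
  proof (rule set_integral_Un)
    show "set_integrable lborel A ?f"
      by (rule set_integrable_subset[OF int[of "Suc n"]]) (auto simp: A_def)
  qed (use int in \<open>auto simp: A_def\<close>)
  finally have "spectral_energy (H0, H) t (Suc n) - spectral_energy (H0, H) t n
      = (\<integral>p. indicator A p * ?f p \<partial>lborel)"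
    by (simp add: set_lebesgue_integral_def)
  also have "\<dots> = r ^ (2 + CARD('d)) * (\<integral>p. indicator A (?S p) * ?f (?S p) \<partial>lborel)"
    using lborel_integral_parabolic[of "\<lambda>p. indicator A p * ?f p" r] r by simp
  also have "(\<lambda>p. indicator A (?S p) * ?f (?S p)) =
      (\<lambda>p. r powr (2 * \<delta> - 2 - real CARD('d)) * (indicator shell p * ?w p))"
  proof
    fix p :: "real \<times> (real ^ 'd)"
    show "indicator A (?S p) * ?f (?S p) =
        r powr (2 * \<delta> - 2 - real CARD('d)) * (indicator shell p * ?w p)"
    \<comment> \<open>Off the shell both indicators vanish. On it, the homogeneity of the symbol
      moves the factor \<open>r\<^sup>2 = 4 ^ n\<close> from the frequency to the time
      \<open>t\<close>.\<close>
    proof (cases "p \<in> shell")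
      case False
      then show ?thesis
        using parabolic_mem_D_iff[of n p 0] parabolic_mem_D_iff[of n p 1]
        by (auto simp: A_def shell_def r_def indicator_def)
    next
      case True
      have A: "?S p \<in> A"
        using True parabolic_mem_D_iff[of n p 0] parabolic_mem_D_iff[of n p 1]
        by (simp add: A_def shell_def r_def)
      have z: "heat_symbol p \<noteq> 0" using one_le_norm_heat_symbol[OF True] by auto
      have r2: "r\<^sup>2 = 4 ^ n" by (simp add: r_def power2_eq_square flip: power_mult_distrib)
      have "heat_symbol (?S p) \<noteq> 0"
        using z r by (simp add: heat_symbol_parabolic)
      then have "cmod (gam t (fst (?S p)) (norm (snd (?S p)))) =
          cmod (1 - exp (- (complex_of_real t * (complex_of_real (r\<^sup>2) * heat_symbol p))))
            / cmod (complex_of_real (r\<^sup>2) * heat_symbol p)"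
        using norm_gam_eq[OF \<open>t \<ge> 0\<close>, of "?S p"] heat_symbol_parabolic[OF r, of p] by simp
      also have "\<dots> = cmod (1 - exp (- (complex_of_real (t * 4 ^ n) * heat_symbol p)))
            / (r\<^sup>2 * cmod (heat_symbol p))"
        using r by (simp add: norm_mult norm_power r2 mult.assoc)
      finally have g: "cmod (gam t (fst (?S p)) (norm (snd (?S p)))) = \<dots>" .
      \<comment> \<open>The power on the left is the scaling of the weight; \<open>r ^ 4\<close>
        comes from the squared symbol in the denominator. What remains is 2 \<delta> minus the
        Jacobian exponent 2 + d, so multiplying by the Jacobian leaves
        \<open>r powr (2 * \<delta>)\<close>.\<close>
      have "r powr (2 + real CARD('d) - 2 * (2 * H0 + (\<Sum>i\<in>UNIV. H $ i))) / r ^ 4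
          = r powr (2 * \<delta> - 2 - real CARD('d))"
        using r unfolding powr_realpow[OF r, of 4, symmetric] powr_diff[symmetric]
        by (simp add: \<delta>_def algebra_simps)
      then show ?thesis
        using True A r unfolding g hurst_weight_parabolic[OF r]
        by (simp add: power_mult_distrib power_divide field_simps flip: power_mult)
    qed
  qed
  also have "r ^ (2 + CARD('d)) * (\<integral>p. r powr (2 * \<delta> - 2 - real CARD('d)) * (indicator shell p * ?w p) \<partial>lborel)
     = (r ^ (2 + CARD('d)) * r powr (2 * \<delta> - 2 - real CARD('d))) * (LINT p:shell|lborel. ?w p)"
    unfolding set_lebesgue_integral_def real_scaleR_def integral_mult_right_zero mult.assoc ..
  also have "r ^ (2 + CARD('d)) * r powr (2 * \<delta> - 2 - real CARD('d)) = (2 powr (2 * \<delta>)) ^ n"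
  proof -
    have "r ^ (2 + CARD('d)) * r powr (2 * \<delta> - 2 - real CARD('d)) = r powr (2 * \<delta>)"
      unfolding powr_realpow[OF r, symmetric] powr_add[symmetric] by simp
    also have "\<dots> = (2 powr (2 * \<delta>)) ^ n"
      by (simp add: r_def powr_power powr_powr mult.commute flip: powr_realpow)
    finally show ?thesis .
  qed
  finally show ?thesis .
qed

section \<open>The limit of the rescaled shell integrals and its positivity\<close>

definition shell_mass :: "real \<times> (real ^ 'd) \<Rightarrow> real" where
  "shell_mass h = (LINT p:shell|lborel. hurst_weight h p / (cmod (heat_symbol p))\<^sup>2)"

lemma hurst_weight_shell_integrable:
  fixes H :: "real ^ 'd"
  assumes "H0 < 1" "\<And>i. H $ i < 1"
  shows "set_integrable lborel shell (hurst_weight (H0, H))"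
proof (rule hurst_weight_integrable)
  show "(H0, H) \<bullet> b < 1" if "b \<in> Basis" for b
    using assms that by (rule inner_Basis_real_vec_less)
  show "bounded (shell :: (real \<times> (real ^ 'd)) set)"
    by (rule bounded_subset[OF bounded_D[of 1]]) (auto simp: shell_def)
qed measurable

text \<open>Where the spatial frequency is 0 the symbol is purely imaginary, and the exponential in
  the shell integral has modulus 1 instead of decaying; this set must be negligible.\<close>

lemma AE_lborel_snd_nonzero: "AE p in lborel. snd (p :: real \<times> (real ^ 'd)) \<noteq> 0"
  using AE_lborel_inner_nonzero
proof eventually_elim
  case (elim p)
  have "(0, axis undefined 1) \<in> (Basis :: (real \<times> (real ^ 'd)) set)"
    unfolding Basis_prod_def Basis_vec_def by auto
  with elim show ?case by (auto simp: inner_prod_def)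
qed

text \<open>Almost everywhere the symbol has positive real part, so the exponential dies out as the
  rescaled time \<open>t * 4 ^ n\<close> grows. Four times the weight dominates, since the numerator
  is at most 4 and the denominator at least 1 on the shell.\<close>

lemma shell_integral_tendsto:
  fixes H :: "real ^ 'd"
  assumes "H0 < 1" "\<And>i. H $ i < 1" "t > 0"
  shows "(\<lambda>n. LINT p:shell|lborel. hurst_weight (H0, H) p *
       (cmod (1 - exp (- (complex_of_real (t * 4 ^ n) * heat_symbol p))))\<^sup>2 / (cmod (heat_symbol p))\<^sup>2)
     \<longlonglongrightarrow> shell_mass (H0, H)"
  unfolding shell_mass_def set_lebesgue_integral_def
proof (rule integral_dominated_convergence)
  let ?h = "hurst_weight (H0, H)"
  show "integrable lborel (\<lambda>p. 4 * (indicator shell p *\<^sub>R ?h p))"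
    using hurst_weight_shell_integrable[OF assms(1,2)] by (simp add: set_integrable_def)
  show "AE p in lborel. (\<lambda>n. indicat_real shell p *\<^sub>R (?h p *
       (cmod (1 - exp (- (complex_of_real (t * 4 ^ n) * heat_symbol p))))\<^sup>2 / (cmod (heat_symbol p))\<^sup>2))
       \<longlonglongrightarrow> indicat_real shell p *\<^sub>R (?h p / (cmod (heat_symbol p))\<^sup>2)"
    using AE_lborel_snd_nonzero
  proof eventually_elim
    case (elim p)
    define c where "c = t * (norm (snd p))\<^sup>2"
    have c: "c > 0" using assms(3) elim by (simp add: c_def)
    have "(\<lambda>n. exp (- (c * 4 ^ n))) \<longlonglongrightarrow> 0"
      by (intro filterlim_compose[OF exp_at_bot] filterlim_uminus_at_top[THEN iffD1]
            filterlim_tendsto_pos_mult_at_top[OF tendsto_const c] filterlim_realpow_at_top) simp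
    then have "(\<lambda>n. exp (- (complex_of_real (t * 4 ^ n) * heat_symbol p))) \<longlonglongrightarrow> 0"
      by (subst tendsto_norm_zero_iff[symmetric]) (simp add: norm_exp_eq_Re c_def mult_ac)
    then have "(\<lambda>n. indicat_real shell p *\<^sub>R (?h p *
       (cmod (1 - exp (- (complex_of_real (t * 4 ^ n) * heat_symbol p))))\<^sup>2 / (cmod (heat_symbol p))\<^sup>2))
       \<longlonglongrightarrow> indicat_real shell p *\<^sub>R (?h p * (cmod (1 - 0))\<^sup>2 / (cmod (heat_symbol p))\<^sup>2)"
      using elim by (intro tendsto_intros) (auto simp: complex_eq_iff)
    then show ?case by simp
  qed
  fix n
  show "AE p in lborel. norm (indicat_real shell p *\<^sub>R (?h p *
       (cmod (1 - exp (- (complex_of_real (t * 4 ^ n) * heat_symbol p))))\<^sup>2 / (cmod (heat_symbol p))\<^sup>2))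
       \<le> 4 * (indicat_real shell p *\<^sub>R ?h p)"
  proof (rule AE_I2)
    fix p :: "real \<times> (real ^ 'd)"
    let ?e = "exp (- (complex_of_real (t * 4 ^ n) * heat_symbol p))"
    show "norm (indicat_real shell p *\<^sub>R (?h p * (cmod (1 - ?e))\<^sup>2 / (cmod (heat_symbol p))\<^sup>2))
       \<le> 4 * (indicat_real shell p *\<^sub>R ?h p)"
    proof (cases "p \<in> shell")
      case True
      have "cmod ?e \<le> 1" using assms(3) by (simp add: norm_exp_eq_Re)
      then have "cmod (1 - ?e) \<le> 2" using norm_triangle_ineq4[of 1 ?e] unfolding norm_one by linarith
      then have "(cmod (1 - ?e))\<^sup>2 \<le> 2\<^sup>2" by (intro power_mono) auto
      moreover have "1 \<le> (cmod (heat_symbol p))\<^sup>2"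
        using one_le_norm_heat_symbol[OF True] by (simp add: one_le_power)
      ultimately have "?h p * (cmod (1 - ?e))\<^sup>2 / (cmod (heat_symbol p))\<^sup>2 \<le> ?h p * 4 / 1"
        using hurst_weight_nonneg[of "(H0, H)" p] by (intro frac_le mult_left_mono) auto
      then show ?thesis using True hurst_weight_nonneg[of "(H0, H)" p] by (simp add: abs_mult)
    qed simp
  qed
qed measurable

lemma shell_mass_pos:
  fixes H :: "real ^ 'd"
  assumes "H0 < 1" "\<And>i. H $ i < 1"
  shows "shell_mass (H0, H) > 0"
proof -
  let ?g = "\<lambda>p. indicat_real shell p *\<^sub>R (hurst_weight (H0, H) p / (cmod (heat_symbol p))\<^sup>2)"
  have nonneg: "?g p \<ge> 0" for p using hurst_weight_nonneg[of "(H0, H)" p] by simp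
  have int: "integrable lborel ?g"
  proof (rule Bochner_Integration.integrable_bound)
    show "integrable lborel (\<lambda>p. indicat_real shell p *\<^sub>R hurst_weight (H0, H) p)"
      using hurst_weight_shell_integrable[OF assms] by (simp add: set_integrable_def)
    show "AE p in lborel. norm (?g p) \<le> norm (indicat_real shell p *\<^sub>R hurst_weight (H0, H) p)"
    proof (rule AE_I2)
      fix p :: "real \<times> (real ^ 'd)"
      show "norm (?g p) \<le> norm (indicat_real shell p *\<^sub>R hurst_weight (H0, H) p)"
      proof (cases "p \<in> shell")
        case True
        then have "1 \<le> (cmod (heat_symbol p))\<^sup>2"
          using one_le_norm_heat_symbol[OF True] by (simp add: one_le_power)
        then have "hurst_weight (H0, H) p / (cmod (heat_symbol p))\<^sup>2 \<le> hurst_weight (H0, H) p / 1"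
          using hurst_weight_nonneg[of "(H0, H)" p] by (intro frac_le) auto
        then show ?thesis using True hurst_weight_nonneg[of "(H0, H)" p] by simp
      qed simp
    qed
  qed measurable
  have "shell_mass (H0, H) = (\<integral>p. ?g p \<partial>lborel)"
    by (simp add: shell_mass_def set_lebesgue_integral_def)
  moreover have "(\<integral>p. ?g p \<partial>lborel) \<ge> 0" using nonneg by (intro Bochner_Integration.integral_nonneg) auto
  moreover have "(\<integral>p. ?g p \<partial>lborel) \<noteq> 0"
  proof
    assume "(\<integral>p. ?g p \<partial>lborel) = 0"
    then have "AE p in lborel. ?g p = 0"
      using integral_nonneg_eq_0_iff_AE[OF int] nonneg by simp
    \<comment> \<open>Off the coordinate hyperplanes the integrand is nonzero on the shell, so a
      zero integral would force the shell to be a null set.\<close>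
    then have "AE p in lborel. p \<notin> (shell :: (real \<times> (real ^ 'd)) set)"
      using AE_lborel_inner_nonzero
    proof eventually_elim
      case (elim p)
      then have "hurst_weight (H0, H) p \<noteq> 0" by (simp add: hurst_weight_def)
      with elim(1) one_le_norm_heat_symbol[of p] show ?case
        by (auto simp: indicator_def)
    qed
    then have "shell \<in> null_sets (lborel :: (real \<times> (real ^ 'd)) measure)"
      by (subst (asm) AE_iff_null_sets[symmetric]) auto
    then have "negligible (shell :: (real \<times> (real ^ 'd)) set)"
      by (simp add: negligible_iff_null_sets null_sets_completionI)
    \<comment> \<open>Time frequency above 1 leaves \<open>D 0\<close>, while the bounds 4 and 1
      stay within \<open>D 1\<close>; thus the shell contains a nonempty open set.\<close>
    moreover have "({1<..<4} \<times> ball 0 1 :: (real \<times> (real ^ 'd)) set) \<subseteq> shell"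
      by (auto simp: shell_def mem_D_iff)
    ultimately have "negligible ({1<..<4} \<times> ball 0 1 :: (real \<times> (real ^ 'd)) set)"
      by (rule negligible_subset)
    moreover have "(2, 0) \<in> ({1<..<4} \<times> ball 0 1 :: (real \<times> (real ^ 'd)) set)" by simp
    ultimately show False
      using open_not_negligible[OF open_Times[OF open_greaterThanLessThan open_ball]] by blast
  qed
  ultimately show ?thesis by linarith
qed

section \<open>Linear and geometric growth of the spectral energy\<close>

lemma spectral_energy_asymptotics:
  fixes H :: "real ^ 'd"
  assumes H: "H0 < 1" "\<And>i. H $ i < 1" and t: "t > 0"
  defines "\<delta> \<equiv> real CARD('d) - (2 * H0 + (\<Sum>i\<in>UNIV. H $ i))"
  shows "\<delta> = 0 \<Longrightarrow> (\<lambda>n. spectral_energy (H0, H) t n / real n) \<longlonglongrightarrow> shell_mass (H0, H)"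
    and "\<delta> > 0 \<Longrightarrow> (\<lambda>n. spectral_energy (H0, H) t n / (2 powr (2 * \<delta>)) ^ n)
           \<longlonglongrightarrow> shell_mass (H0, H) / (2 powr (2 * \<delta>) - 1)"
proof -
  let ?F = "\<lambda>n. LINT p:shell|lborel. hurst_weight (H0, H) p *
       (cmod (1 - exp (- (complex_of_real (t * 4 ^ n) * heat_symbol p))))\<^sup>2 / (cmod (heat_symbol p))\<^sup>2"
  let ?E = "spectral_energy (H0, H) t" and ?q = "2 powr (2 * \<delta>)"
  have diff: "?E (Suc n) - ?E n = ?q ^ n * ?F n" for n
    using spectral_energy_Suc_diff[OF H, of t n] t by (simp add: \<delta>_def)
  have lim: "?F \<longlonglongrightarrow> shell_mass (H0, H)"
    by (rule shell_integral_tendsto[OF H t])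
  \<comment> \<open>With \<delta> = 0 the ratio \<open>?q\<close> is 1, so the increments are the
    shell integrals themselves and the denominators grow by 1.\<close>
  show "(\<lambda>n. ?E n / real n) \<longlonglongrightarrow> shell_mass (H0, H)" if "\<delta> = 0"
    by (rule stolz_cesaro_mono) (use lim that in \<open>simp_all add: diff filterlim_real_sequentially\<close>)
  assume \<delta>: "\<delta> > 0"
  have q: "?q > 1" using \<delta> by simp
  show "(\<lambda>n. ?E n / ?q ^ n) \<longlonglongrightarrow> shell_mass (H0, H) / (?q - 1)"
  proof (rule stolz_cesaro_mono)
    show "?q ^ n < ?q ^ Suc n" for n using q by simp
    show "filterlim (\<lambda>n. ?q ^ n) at_top sequentially"
      using q by (rule filterlim_realpow_at_top)
    \<comment> \<open>The common factor \<open>?q ^ n\<close> cancels; the remaining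
      \<open>?q - 1\<close> accounts for the denominator of the limit.\<close>
    have "(?E (Suc n) - ?E n) / (?q ^ Suc n - ?q ^ n) = ?F n / (?q - 1)" for n
    proof -
      have "?q ^ Suc n - ?q ^ n = ?q ^ n * (?q - 1)" by (simp add: algebra_simps)
      then show ?thesis unfolding diff using q by simp
    qed
    then show "(\<lambda>n. (?E (Suc n) - ?E n) / (?q ^ Suc n - ?q ^ n)) \<longlonglongrightarrow> shell_mass (H0, H) / (?q - 1)"
      using q lim by (simp only:) (intro tendsto_intros, auto)
  qed
qed

section \<open>Transfer to the Gaussian field and choice of the constants\<close>

theorem proposition1p6:
  fixes H0 cH :: real and H :: "real ^ 'd"
  assumes "0 < H0" "H0 < 1"
    and "\<And>i. 0 < H $ i \<and> H $ i < 1"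
    and "2 * H0 + (\<Sum>i\<in>UNIV. H $ i) \<le> real CARD('d)"
    and "cH > 0"
  shows "(\<forall>(M :: 'w measure) \<Psi>. is_Psi cH H0 H M \<Psi> \<longrightarrow>
            (\<forall>n\<ge>1. \<forall>t\<ge>0. \<forall>x y. Psi_sigma M \<Psi> n t x = Psi_sigma M \<Psi> n t y)) \<and>
         (\<exists>c1 > 0. \<exists>c2 > 0. \<forall>(M :: 'w measure) \<Psi>. is_Psi cH H0 H M \<Psi> \<longrightarrow>
            (\<forall>T > 0. \<forall>t \<in> {0<..T}. \<forall>x.
               (\<lambda>n. Psi_sigma M \<Psi> n t x /
                  (if 2 * H0 + (\<Sum>i\<in>UNIV. H $ i) = real CARD('d) then c1 * real n
                   else c2 * 2 powr (2 * real n * (real CARD('d) - (2 * H0 + (\<Sum>i\<in>UNIV. H $ i))))))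
               \<longlonglongrightarrow> 1))"
proof -
  define \<delta> where "\<delta> = real CARD('d) - (2 * H0 + (\<Sum>i\<in>UNIV. H $ i))"
  define L where "L = cH\<^sup>2 * shell_mass (H0, H)"
  have H: "H0 < 1" "\<And>i. H $ i < 1" and "\<delta> \<ge> 0" using assms by (auto simp: \<delta>_def)
  have L: "L > 0" using shell_mass_pos[OF H] \<open>cH > 0\<close> by (simp add: L_def)
  have sigma: "Psi_sigma M \<Psi> n t x = cH\<^sup>2 * spectral_energy (H0, H) t n"
    if "is_Psi cH H0 H M \<Psi>" "n \<ge> 1" "t \<ge> 0" for M :: "'w measure" and \<Psi> n t x
  proof -
    have "complex_of_real (Psi_sigma M \<Psi> n t x) = Psi_cov cH H0 H n t x n t x"
      using that unfolding is_Psi_def Psi_sigma_def power2_eq_square by blast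
    then show ?thesis unfolding Psi_cov_diagonal of_real_eq_iff .
  qed
  \<comment> \<open>For \<delta> = 0 the quotient would be division by zero and hence 0, so a
    positive default is chosen. Both \<open>L\<close> and \<open>c\<close> are built from
    \<open>cH\<close>, \<open>H0\<close> and \<open>H\<close> alone, uniformly in the process,
    \<open>t\<close> and \<open>x\<close>.\<close>
  define c where "c = (if \<delta> = 0 then 1 else L / (2 powr (2 * \<delta>) - 1))"
  have "c > 0"
    using L \<open>\<delta> \<ge> 0\<close> by (auto simp: c_def intro!: divide_pos_pos)
  have main: "(\<lambda>n. Psi_sigma M \<Psi> n t x / (if \<delta> = 0 then L * real n else c * 2 powr (2 * real n * \<delta>)))
      \<longlonglongrightarrow> 1"
    if \<Psi>: "is_Psi cH H0 H M \<Psi>" and t: "t > 0" for M :: "'w measure" and \<Psi> t x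
  proof (cases "\<delta> = 0")
    case True
    have "(\<lambda>n. cH\<^sup>2 / L * (spectral_energy (H0, H) t n / real n)) \<longlonglongrightarrow> cH\<^sup>2 / L * shell_mass (H0, H)"
      using spectral_energy_asymptotics(1)[OF H t] True by (intro tendsto_intros) (simp add: \<delta>_def)
    also have "cH\<^sup>2 / L * shell_mass (H0, H) = 1" using L by (auto simp: L_def)
    finally show ?thesis
      \<comment> \<open>The covariance is prescribed from \<open>n = 1\<close> on, so
        \<open>sigma\<close> identifies the two sequences only eventually.\<close>
      by (rule Lim_transform_eventually)
         (use sigma[OF \<Psi>, of _ t x] t True in \<open>auto intro!: eventually_mono[OF eventually_ge_at_top[of 1]]\<close>)
  next
    case False
    then have \<delta>: "\<delta> > 0" using \<open>\<delta> \<ge> 0\<close> by simp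
    then have q: "2 powr (2 * \<delta>) > 1" by simp
    have "(\<lambda>n. cH\<^sup>2 / c * (spectral_energy (H0, H) t n / (2 powr (2 * \<delta>)) ^ n))
        \<longlonglongrightarrow> cH\<^sup>2 / c * (shell_mass (H0, H) / (2 powr (2 * \<delta>) - 1))"
      using spectral_energy_asymptotics(2)[OF H t, folded \<delta>_def, OF \<delta>] by (rule tendsto_mult_left)
    also have "cH\<^sup>2 / c * (shell_mass (H0, H) / (2 powr (2 * \<delta>) - 1)) = 1"
      using L q False by (auto simp: L_def c_def)
    finally have "(\<lambda>n. cH\<^sup>2 * spectral_energy (H0, H) t n / (c * (2 powr (2 * \<delta>)) ^ n)) \<longlonglongrightarrow> 1"
      by simp
    moreover have "(2 powr (2 * \<delta>)) ^ n = 2 powr (2 * real n * \<delta>)" for n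
      by (simp add: powr_power mult_ac)
    ultimately have "(\<lambda>n. cH\<^sup>2 * spectral_energy (H0, H) t n / (c * 2 powr (2 * real n * \<delta>))) \<longlonglongrightarrow> 1"
      by simp
    then show ?thesis
      by (rule Lim_transform_eventually)
         (use sigma[OF \<Psi>, of _ t x] t False in \<open>auto intro!: eventually_mono[OF eventually_ge_at_top[of 1]]\<close>)
  qed
  have \<delta>_0: "2 * H0 + (\<Sum>i\<in>UNIV. H $ i) = real CARD('d) \<longleftrightarrow> \<delta> = 0"
    by (auto simp: \<delta>_def)
  show ?thesis
    unfolding \<delta>_0 \<delta>_def[symmetric]
  proof (intro conjI)
    show "\<exists>c1>0. \<exists>c2>0. \<forall>(M :: 'w measure) \<Psi>. is_Psi cH H0 H M \<Psi> \<longrightarrow>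
        (\<forall>T>0. \<forall>t\<in>{0<..T}. \<forall>x.
          (\<lambda>n. Psi_sigma M \<Psi> n t x / (if \<delta> = 0 then c1 * real n else c2 * 2 powr (2 * real n * \<delta>)))
            \<longlonglongrightarrow> 1)"
      using L \<open>c > 0\<close> main by (intro exI[of _ L] exI[of _ c] conjI) simp_all
  qed (simp add: sigma)
qed

end
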